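(* Let $(a_n)_{n\in\mathbb{N}}$ and $(b_{n,j})_{n,j\in\mathbb{N}}$ be real numbers with $a_n\ge 0$ for all $n$, $b_{n,j}\ge 0$ for all $n,j$, and $b_{n,j}=0$ whenever $n\ge j$. Let $w$ be a weight such that $w_n\ge n$ for all $n\in\mathbb{N}$ and such that there exists $\kappa\in(0,1]$ with $$\sum_{n=1}^{j-1}w_nb_{n,j}\le\kappa w_j\quad\text{for all } j=2,3,\ldots.\qquad(\ast)$$ (i) Then $\lim_{t\to\infty}\|S^{(w)}(t)\mathring{u}\|_w=0$ for all $\mathring{u}\in\ell_w^1$ if and only if $a_n>0$ for all $n\in\mathbb{N}$. (ii) If, additionally, $w$ is such that $(\ast)$ holds with some $\kappa\in(0,1)$, and $a_0:=\inf_{n\in\mathbb{N}}a_n$, then (for this $\kappa$) $$\|S^{(w)}(t)\|\le e^{-(1-\kappa)a_0t}\quad\text{for all } t\ge0,$$ and hence, if $a_0>0$ and $\alpha\in[0,(1-\kappa)a_0)$, we have $$\lim_{t\to\infty}e^{\alpha t}\|S^{(w)}(t)\mathring{u}\|_w=0\quad\text{for every }\mathring{u}\in\ell_w^1.\qquad(\ast\ast)$$ If $\alpha>a_0$, then $(\ast\ast)$ does not hold (i.e. it fails for some $\mathring{u}\in\ell_w^1$). In particular, if $a_0=0$, then $(\ast\ast)$ does not hold for any $\alpha>0$.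
   Context: $\mathbb{N}=\{1,2,\ldots\}$. A weight is a sequence $w=(w_n)_{n=1}^\infty$ of strictly positive reals, and $\ell_w^1$ is the Banach space of sequences $f=(f_n)_{n=1}^\infty$ with $\|f\|_w=\sum_{n=1}^\infty w_n|f_n|<\infty$. Operators: $A^{(w)}f=(-a_nf_n)_{n=1}^\infty$ with $\mathcal{D}(A^{(w)})=\{f\in\ell_w^1:(a_nf_n)_n\in\ell_w^1\}$; $B^{(w)}f=\bigl(\sum_{j=n+1}^\infty a_jb_{n,j}f_j\bigr)_{n=1}^\infty$ with $\mathcal{D}(B^{(w)})$ the set of $f\in\ell_w^1$ for which this sequence is well defined and lies in $\ell_w^1$. Under the stated hypotheses (with $\kappa\in(0,1]$), the closure $G^{(w)}=\overline{A^{(w)}+B^{(w)}}$ generates a substochastic $C_0$-semigroup on $\ell_w^1$ (positive, and contractive on the cone of componentwise non-negative sequences), denoted $(S^{(w)}(t))_{t\ge0}$. $\|S^{(w)}(t)\|$ is the operator norm on $\ell_w^1$. *)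

theory Defs
  imports "HOL-Analysis.Analysis"
begin

text \<open>
  Sequences indexed by \<open>1, 2, \<dots>\<close> are functions on \<^typ>\<open>nat\<close>. Elements of the sequence space
  take the value \<open>0\<close> at the unused index \<open>0\<close>, so that equality of functions is equality of
  sequences. The values at index \<open>0\<close> of weights and coefficients never matter.
\<close>

definition is_weight :: "(nat \<Rightarrow> real) \<Rightarrow> bool" where
  "is_weight w \<longleftrightarrow> (\<forall>n\<ge>1. 0 < w n)"

definition ell1 :: "(nat \<Rightarrow> real) \<Rightarrow> (nat \<Rightarrow> real) set" where
  "ell1 w = {f. f 0 = 0 \<and> summable (\<lambda>i. w (i + 1) * \<bar>f (i + 1)\<bar>)}"

definition wnorm :: "(nat \<Rightarrow> real) \<Rightarrow> (nat \<Rightarrow> real) \<Rightarrow> real" where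
  "wnorm w f = (\<Sum>i. w (i + 1) * \<bar>f (i + 1)\<bar>)"

text \<open>
  A (generally unbounded) operator in \<open>ell1 w\<close> with domain \<open>D\<close> is represented by its graph, a set
  of pairs whose first projection is \<open>D\<close>.
\<close>

type_synonym seq_op = "((nat \<Rightarrow> real) \<times> (nat \<Rightarrow> real)) set"

definition op_A :: "(nat \<Rightarrow> real) \<Rightarrow> (nat \<Rightarrow> real) \<Rightarrow> seq_op" where
  "op_A w a = {(f, g). f \<in> ell1 w \<and> (\<lambda>n. a n * f n) \<in> ell1 w \<and> g = (\<lambda>n. - (a n * f n))}"

text \<open>
  In \<open>op_B\<close>, the sequence being well defined means that every series over \<open>j = n + 1, n + 2, \<dots>\<close>
  converges; the summation index is \<open>i = j - (n + 1)\<close>.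
\<close>

definition op_B :: "(nat \<Rightarrow> real) \<Rightarrow> (nat \<Rightarrow> real) \<Rightarrow> (nat \<Rightarrow> nat \<Rightarrow> real) \<Rightarrow> seq_op" where
  "op_B w a b = {(f, g). f \<in> ell1 w \<and> g \<in> ell1 w \<and>
     (\<forall>n\<ge>1. (\<lambda>i. a (n + 1 + i) * b n (n + 1 + i) * f (n + 1 + i)) sums g n)}"

definition op_plus :: "seq_op \<Rightarrow> seq_op \<Rightarrow> seq_op" where
  "op_plus T U = {(f, g). \<exists>g1 g2. (f, g1) \<in> T \<and> (f, g2) \<in> U \<and> g = (\<lambda>n. g1 n + g2 n)}"

definition op_closure :: "(nat \<Rightarrow> real) \<Rightarrow> seq_op \<Rightarrow> seq_op" where
  "op_closure w T = {(f, g). f \<in> ell1 w \<and> g \<in> ell1 w \<and>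
     (\<exists>F G. (\<forall>k::nat. (F k, G k) \<in> T) \<and>
        (\<lambda>k. wnorm w (\<lambda>n. F k n - f n)) \<longlonglongrightarrow> 0 \<and>
        (\<lambda>k. wnorm w (\<lambda>n. G k n - g n)) \<longlonglongrightarrow> 0)}"

definition bounded_linear_op ::
  "(nat \<Rightarrow> real) \<Rightarrow> ((nat \<Rightarrow> real) \<Rightarrow> (nat \<Rightarrow> real)) \<Rightarrow> bool" where
  "bounded_linear_op w T \<longleftrightarrow>
     (\<forall>f\<in>ell1 w. T f \<in> ell1 w) \<and>
     (\<forall>f\<in>ell1 w. \<forall>g\<in>ell1 w. T (\<lambda>n. f n + g n) = (\<lambda>n. T f n + T g n)) \<and>
     (\<forall>c. \<forall>f\<in>ell1 w. T (\<lambda>n. c * f n) = (\<lambda>n. c * T f n)) \<and>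
     (\<exists>M. \<forall>f\<in>ell1 w. wnorm w (T f) \<le> M * wnorm w f)"

definition op_norm :: "(nat \<Rightarrow> real) \<Rightarrow> ((nat \<Rightarrow> real) \<Rightarrow> (nat \<Rightarrow> real)) \<Rightarrow> real" where
  "op_norm w T = (SUP f\<in>{f \<in> ell1 w. wnorm w f \<le> 1}. wnorm w (T f))"

definition C0_semigroup ::
  "(nat \<Rightarrow> real) \<Rightarrow> (real \<Rightarrow> (nat \<Rightarrow> real) \<Rightarrow> (nat \<Rightarrow> real)) \<Rightarrow> bool" where
  "C0_semigroup w S \<longleftrightarrow>
     (\<forall>t\<ge>0. bounded_linear_op w (S t)) \<and>
     (\<forall>f\<in>ell1 w. S 0 f = f) \<and>
     (\<forall>s\<ge>0. \<forall>t\<ge>0. \<forall>f\<in>ell1 w. S (s + t) f = S s (S t f)) \<and>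
     (\<forall>f\<in>ell1 w. ((\<lambda>t. wnorm w (\<lambda>n. S t f n - f n)) \<longlongrightarrow> 0) (at_right 0))"

definition generator ::
  "(nat \<Rightarrow> real) \<Rightarrow> (real \<Rightarrow> (nat \<Rightarrow> real) \<Rightarrow> (nat \<Rightarrow> real)) \<Rightarrow> seq_op" where
  "generator w S = {(f, g). f \<in> ell1 w \<and> g \<in> ell1 w \<and>
     ((\<lambda>h. wnorm w (\<lambda>n. (S h f n - f n) / h - g n)) \<longlongrightarrow> 0) (at_right 0)}"

text \<open>
  \<open>S\<close> is the semigroup of the fragmentation system with coefficients \<open>a\<close>, \<open>b\<close>. A \<open>C\<^sub>0\<close>-semigroup
  is determined on \<open>ell1 w\<close> by its generator, so at most one \<open>S\<close> (up to values at negative times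
  and outside \<open>ell1 w\<close>) satisfies this.
\<close>

definition frag_semigroup :: "(nat \<Rightarrow> real) \<Rightarrow> (nat \<Rightarrow> real) \<Rightarrow> (nat \<Rightarrow> nat \<Rightarrow> real) \<Rightarrow>
    (real \<Rightarrow> (nat \<Rightarrow> real) \<Rightarrow> (nat \<Rightarrow> real)) \<Rightarrow> bool" where
  "frag_semigroup w a b S \<longleftrightarrow>
     C0_semigroup w S \<and> generator w S = op_closure w (op_plus (op_A w a) (op_B w a b))"

definition weight_cond :: "(nat \<Rightarrow> real) \<Rightarrow> (nat \<Rightarrow> nat \<Rightarrow> real) \<Rightarrow> real \<Rightarrow> bool" where
  "weight_cond w b \<kappa> \<longleftrightarrow> (\<forall>j\<ge>2. (\<Sum>n=1..j-1. w n * b n j) \<le> \<kappa> * w j)"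

definition exp_decay ::
  "(nat \<Rightarrow> real) \<Rightarrow> (real \<Rightarrow> (nat \<Rightarrow> real) \<Rightarrow> (nat \<Rightarrow> real)) \<Rightarrow> real \<Rightarrow> bool" where
  "exp_decay w S \<alpha> \<longleftrightarrow>
     (\<forall>u\<in>ell1 w. ((\<lambda>t. exp (\<alpha> * t) * wnorm w (S t u)) \<longlongrightarrow> 0) at_top)"

end

theory Submission
  imports Defs
begin

text \<open>
  The unit sequences \<open>e\<^sub>n\<close> lie in the domain of the generator \<open>G\<close>, and \<open>G e\<^sub>n\<close> is a combination
  of \<open>e\<^sub>1, \<dots>, e\<^sub>n\<close>. Hence every coordinate of the orbits \<open>S t e\<^sub>n\<close> solves the scalar
  triangular system \<open>\<phi>\<^sub>n' = - a\<^sub>n \<phi>\<^sub>n + (\<Sum>m<n. a\<^sub>n b\<^sub>m\<^sub>n \<phi>\<^sub>m)\<close>. Comparison arguments, by induction on \<open>n\<close>, give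
  positivity, the lower bound \<open>exp (- a\<^sub>n t)\<close> for the \<open>n\<close>-th coordinate of \<open>S t e\<^sub>n\<close>, and upper
  bounds for the norm of \<open>S t e\<^sub>n\<close>. Since an operator bound on \<open>\<ell>\<^sup>1\<close> can be read off from the unit
  sequences, these estimates decide all questions of decay; of the closure only the inclusion of
  \<open>A + B\<close> in \<open>G\<close> matters. Two-sided differentiability of the orbits needs local boundedness of
  the semigroup, which comes from the uniform boundedness principle.
\<close>

section \<open>The weighted sequence space\<close>

lemma ell1_0: "f \<in> ell1 w \<Longrightarrow> f 0 = 0"
  and ell1_summable: "f \<in> ell1 w \<Longrightarrow> summable (\<lambda>i. w (i + 1) * \<bar>f (i + 1)\<bar>)"
  by (auto simp: ell1_def)

lemma wnorm_sums: "f \<in> ell1 w \<Longrightarrow> (\<lambda>i. w (i + 1) * \<bar>f (i + 1)\<bar>) sums wnorm w f"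
  by (simp add: wnorm_def ell1_def summable_sums)

lemma wnorm_eqI: "(\<lambda>i. w (i + 1) * \<bar>f (i + 1)\<bar>) sums s \<Longrightarrow> wnorm w f = s"
  by (simp add: wnorm_def sums_iff)

lemma ell1_zero [simp]: "(\<lambda>n. 0) \<in> ell1 w"
  and wnorm_zero [simp]: "wnorm w (\<lambda>n. 0) = 0"
  by (auto simp: ell1_def wnorm_def)

lemma ell1_scale:
  assumes "f \<in> ell1 w" shows "(\<lambda>n. c * f n) \<in> ell1 w"
    and "wnorm w (\<lambda>n. c * f n) = \<bar>c\<bar> * wnorm w f"
proof -
  have *: "(\<lambda>i. w (i + 1) * \<bar>c * f (i + 1)\<bar>) sums (\<bar>c\<bar> * wnorm w f)"
    using sums_mult[OF wnorm_sums[OF assms], of "\<bar>c\<bar>"] by (simp add: abs_mult mult_ac)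
  then show "wnorm w (\<lambda>n. c * f n) = \<bar>c\<bar> * wnorm w f" by (rule wnorm_eqI)
  show "(\<lambda>n. c * f n) \<in> ell1 w"
    using * assms by (auto simp: ell1_def sums_iff)
qed

definition unit_seq :: "nat \<Rightarrow> nat \<Rightarrow> real" where
  "unit_seq m = (\<lambda>n. if n = m then 1 else 0)"

lemma unit_seq_ell1: "m \<ge> 1 \<Longrightarrow> unit_seq m \<in> ell1 w"
  unfolding ell1_def
  by (auto simp: unit_seq_def intro!: summable_finite[of "{m - 1}"] split: if_splits)

section \<open>Norm estimates and completeness of the weighted space\<close>

locale weight =
  fixes w :: "nat \<Rightarrow> real"
  assumes is_weight: "is_weight w"
begin

lemma weight_pos: "n \<ge> 1 \<Longrightarrow> 0 < w n"
  using is_weight by (simp add: is_weight_def)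

lemma weight_Suc [simp]: "0 < w (Suc i)" "0 \<le> w (Suc i)"
  using weight_pos[of "Suc i"] by simp_all

lemma wnorm_nonneg: "f \<in> ell1 w \<Longrightarrow> 0 \<le> wnorm w f"
  unfolding wnorm_def by (rule suminf_nonneg) (auto simp: ell1_def)

lemma ell1_add:
  assumes "f \<in> ell1 w" "g \<in> ell1 w"
  shows "(\<lambda>n. f n + g n) \<in> ell1 w" and "wnorm w (\<lambda>n. f n + g n) \<le> wnorm w f + wnorm w g"
proof -
  have s: "summable (\<lambda>i. w (i + 1) * \<bar>f (i + 1)\<bar> + w (i + 1) * \<bar>g (i + 1)\<bar>)"
    using assms by (auto simp: ell1_def intro: summable_add)
  have le: "w (i + 1) * \<bar>f (i + 1) + g (i + 1)\<bar>
      \<le> w (i + 1) * \<bar>f (i + 1)\<bar> + w (i + 1) * \<bar>g (i + 1)\<bar>" for i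
    using weight_pos[of "i + 1"] by (simp add: abs_triangle_ineq flip: distrib_left)
  have s': "summable (\<lambda>i. w (i + 1) * \<bar>f (i + 1) + g (i + 1)\<bar>)"
    by (rule summable_comparison_test'[OF s, of 0])
       (use le weight_pos in \<open>simp add: abs_mult abs_of_pos\<close>)
  then show "(\<lambda>n. f n + g n) \<in> ell1 w"
    using assms by (simp add: ell1_def)
  have "wnorm w (\<lambda>n. f n + g n)
      \<le> (\<Sum>i. w (i + 1) * \<bar>f (i + 1)\<bar> + w (i + 1) * \<bar>g (i + 1)\<bar>)"
    unfolding wnorm_def using s' s le by (intro suminf_le) auto
  also have "\<dots> = wnorm w f + wnorm w g"
    unfolding wnorm_def using assms by (intro suminf_add[symmetric]) (auto simp: ell1_def)
  finally show "wnorm w (\<lambda>n. f n + g n) \<le> wnorm w f + wnorm w g" .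
qed

lemma ell1_diff:
  assumes "f \<in> ell1 w" "g \<in> ell1 w"
  shows "(\<lambda>n. f n - g n) \<in> ell1 w" and "wnorm w (\<lambda>n. f n - g n) \<le> wnorm w f + wnorm w g"
  using ell1_add[OF assms(1) ell1_scale(1)[OF assms(2), of "-1"]] ell1_scale(2)[OF assms(2), of "-1"]
  by simp_all

lemma wnorm_minus_commute: "wnorm w (\<lambda>n. f n - g n) = wnorm w (\<lambda>n. g n - f n)"
  by (simp add: wnorm_def abs_minus_commute)

lemma wnorm_le_diff:
  assumes "f \<in> ell1 w" "g \<in> ell1 w"
  shows "wnorm w f \<le> wnorm w g + wnorm w (\<lambda>n. f n - g n)"
  using ell1_add(2)[OF assms(2) ell1_diff(1)[OF assms]] by simp

lemma coord_le_wnorm: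
  assumes "f \<in> ell1 w" "k \<ge> 1"
  shows "w k * \<bar>f k\<bar> \<le> wnorm w f"
proof -
  have "(\<Sum>i\<in>{k - 1}. w (i + 1) * \<bar>f (i + 1)\<bar>) \<le> wnorm w f"
    unfolding wnorm_def using ell1_summable[OF assms(1)]
    by (intro sum_le_suminf) auto
  with assms show ?thesis by simp
qed

lemma sum_le_wnorm:
  assumes "f \<in> ell1 w"
  shows "(\<Sum>k=1..K. w k * \<bar>f k\<bar>) \<le> wnorm w f"
proof -
  have "(\<Sum>k=1..K. w k * \<bar>f k\<bar>) = (\<Sum>i<K. w (i + 1) * \<bar>f (i + 1)\<bar>)"
    by (rule sum.reindex_bij_witness[of _ "\<lambda>i. i + 1" "\<lambda>i. i - 1"]) auto
  also have "\<dots> \<le> wnorm w f"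
    unfolding wnorm_def using ell1_summable[OF assms] by (intro sum_le_suminf) auto
  finally show ?thesis .
qed

lemma wnorm_leI:
  assumes "f \<in> ell1 w" "\<And>K. (\<Sum>k=1..K. w k * \<bar>f k\<bar>) \<le> C"
  shows "wnorm w f \<le> C"
  unfolding wnorm_def
proof (rule suminf_le_const[OF ell1_summable[OF assms(1)]])
  fix n
  have "(\<Sum>i<n. w (i + 1) * \<bar>f (i + 1)\<bar>) = (\<Sum>k=1..n. w k * \<bar>f k\<bar>)"
    by (rule sum.reindex_bij_witness[of _ "\<lambda>i. i - 1" "\<lambda>i. i + 1"]) auto
  with assms(2) show "(\<Sum>i<n. w (i + 1) * \<bar>f (i + 1)\<bar>) \<le> C" by simp
qed

lemma ell1_sum:
  assumes "finite F" "\<And>m. m \<in> F \<Longrightarrow> f m \<in> ell1 w"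
  shows "(\<lambda>n. \<Sum>m\<in>F. f m n) \<in> ell1 w \<and> wnorm w (\<lambda>n. \<Sum>m\<in>F. f m n) \<le> (\<Sum>m\<in>F. wnorm w (f m))"
  using assms
proof (induction F rule: finite_induct)
  case (insert x F)
  then show ?case
    using ell1_add[of "f x" "\<lambda>n. \<Sum>m\<in>F. f m n"] by fastforce
qed auto

text \<open>Completeness in the form of absolutely convergent series. Each coordinate is controlled
  by the norm, so the sum exists coordinatewise; a partial sum of its norm series involves finitely
  many coordinates and can be interchanged with the series over \<open>k\<close>.\<close>

lemma ell1_complete:
  assumes d: "\<And>k. d k \<in> ell1 w" and s: "summable (\<lambda>k. wnorm w (d k))"
  shows "(\<lambda>n. \<Sum>k. d k n) \<in> ell1 w"
    and "wnorm w (\<lambda>n. \<Sum>k. d k n) \<le> (\<Sum>k. wnorm w (d k))"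
    and "\<And>n. summable (\<lambda>k. d k n)"
proof -
  have abs_s: "summable (\<lambda>k. \<bar>d k n\<bar>)" for n
  proof (cases "n = 0")
    case False
    then have wn: "w n > 0" using weight_pos by simp
    have "\<bar>d k n\<bar> \<le> wnorm w (d k) / w n" for k
      using coord_le_wnorm[OF d, of n k] False wn by (simp add: field_simps)
    then show ?thesis
      by (intro summable_comparison_test'[OF summable_divide[OF s, of "w n"], of 0]) auto
  qed (use ell1_0[OF d] in simp)
  then show sd: "summable (\<lambda>k. d k n)" for n
    by (rule summable_rabs_cancel)
  have partial: "(\<Sum>i<I. w (i + 1) * \<bar>\<Sum>k. d k (i + 1)\<bar>) \<le> (\<Sum>k. wnorm w (d k))" for I
  proof -
    have "(\<Sum>i<I. w (i + 1) * \<bar>\<Sum>k. d k (i + 1)\<bar>)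
        \<le> (\<Sum>i<I. w (i + 1) * (\<Sum>k. \<bar>d k (i + 1)\<bar>))"
      using summable_rabs[OF abs_s]
      by (intro sum_mono mult_left_mono) auto
    also have "\<dots> = (\<Sum>i<I. \<Sum>k. w (i + 1) * \<bar>d k (i + 1)\<bar>)"
      using suminf_mult[OF abs_s] by simp
    also have "\<dots> = (\<Sum>k. \<Sum>i<I. w (i + 1) * \<bar>d k (i + 1)\<bar>)"
      by (rule suminf_sum[symmetric]) (rule summable_mult[OF abs_s])
    also have "\<dots> \<le> (\<Sum>k. wnorm w (d k))"
    proof (rule suminf_le)
      show "(\<Sum>i<I. w (i + 1) * \<bar>d k (i + 1)\<bar>) \<le> wnorm w (d k)" for k
        unfolding wnorm_def using ell1_summable[OF d]
        by (intro sum_le_suminf) auto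
    qed (intro s summable_sum summable_mult abs_s)+
    finally show ?thesis .
  qed
  have sX: "summable (\<lambda>i. w (i + 1) * \<bar>\<Sum>k. d k (i + 1)\<bar>)"
    by (rule bounded_imp_summable[where B = "\<Sum>k. wnorm w (d k)"])
       (use partial partial[of "Suc _"] in \<open>auto simp: lessThan_Suc_atMost\<close>)
  then show "(\<lambda>n. \<Sum>k. d k n) \<in> ell1 w"
    using ell1_0[OF d] by (simp add: ell1_def)
  show "wnorm w (\<lambda>n. \<Sum>k. d k n) \<le> (\<Sum>k. wnorm w (d k))"
    unfolding wnorm_def[of w "\<lambda>n. \<Sum>k. d k n"] using sX partial by (rule suminf_le_const)
qed

text \<open>Encoded as a finite combination of unit sequences, not by cases as in
  \<open>trunc_eq\<close>, so that linear operators can be applied termwise.\<close>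

definition trunc :: "nat \<Rightarrow> (nat \<Rightarrow> real) \<Rightarrow> nat \<Rightarrow> real" where
  "trunc N f = (\<lambda>n. \<Sum>m=1..N. f m * unit_seq m n)"

lemma trunc_eq: "trunc N f n = (if 1 \<le> n \<and> n \<le> N then f n else 0)"
  by (simp add: trunc_def unit_seq_def if_distrib sum.delta cong: if_cong)

lemma trunc_ell1: "trunc N f \<in> ell1 w"
  unfolding trunc_def
  by (rule conjunct1[OF ell1_sum]) (auto intro!: ell1_scale(1) unit_seq_ell1)

lemma wnorm_diff_trunc:
  assumes "f \<in> ell1 w"
  shows "wnorm w (\<lambda>n. f n - trunc N f n) = wnorm w f - (\<Sum>i<N. w (i + 1) * \<bar>f (i + 1)\<bar>)"
proof (rule wnorm_eqI)
  have "(\<lambda>i. if i \<in> {..<N} then w (i + 1) * \<bar>f (i + 1)\<bar> else 0)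
      sums (\<Sum>i<N. w (i + 1) * \<bar>f (i + 1)\<bar>)"
    by (rule sums_If_finite_set) simp
  from sums_diff[OF wnorm_sums[OF assms] this]
  show "(\<lambda>i. w (i + 1) * \<bar>f (i + 1) - trunc N f (i + 1)\<bar>)
      sums (wnorm w f - (\<Sum>i<N. w (i + 1) * \<bar>f (i + 1)\<bar>))"
    by (rule back_subst[where P = "\<lambda>f. f sums _"]) (auto simp: trunc_eq)
qed

text \<open>Density of the finitely supported sequences: the error is a tail of the convergent norm
  series.\<close>

lemma trunc_tendsto:
  assumes "f \<in> ell1 w"
  shows "(\<lambda>N. wnorm w (\<lambda>n. f n - trunc N f n)) \<longlonglongrightarrow> 0"
  using tendsto_diff[OF tendsto_const wnorm_sums[OF assms, unfolded sums_def], of "wnorm w f"]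
  by (simp add: wnorm_diff_trunc[OF assms])

section \<open>Bounded operators and uniform boundedness\<close>

context
  fixes T assumes T: "bounded_linear_op w T"
begin

lemma op_ell1: "f \<in> ell1 w \<Longrightarrow> T f \<in> ell1 w"
  and op_add: "f \<in> ell1 w \<Longrightarrow> g \<in> ell1 w \<Longrightarrow> T (\<lambda>n. f n + g n) = (\<lambda>n. T f n + T g n)"
  and op_scale: "f \<in> ell1 w \<Longrightarrow> T (\<lambda>n. c * f n) = (\<lambda>n. c * T f n)"
  using T by (auto simp: bounded_linear_op_def)

lemma op_diff:
  assumes "f \<in> ell1 w" "g \<in> ell1 w"
  shows "T (\<lambda>n. f n - g n) = (\<lambda>n. T f n - T g n)"
  using op_add[OF assms(1) ell1_scale(1)[OF assms(2), of "-1"]] op_scale[OF assms(2), of "-1"] by simp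

lemma op_sum:
  assumes "finite F" "\<And>m. m \<in> F \<Longrightarrow> f m \<in> ell1 w"
  shows "T (\<lambda>n. \<Sum>m\<in>F. c m * f m n) = (\<lambda>n. \<Sum>m\<in>F. c m * T (f m) n)"
  using assms
proof (induction F rule: finite_induct)
  case empty
  show ?case using op_scale[OF ell1_zero, of 0] by simp
next
  case (insert x F)
  then have "(\<lambda>n. c x * f x n) \<in> ell1 w" "(\<lambda>n. \<Sum>m\<in>F. c m * f m n) \<in> ell1 w"
    using ell1_sum[of F "\<lambda>m n. c m * f m n"] by (auto intro: ell1_scale)
  with insert show ?case by (simp add: op_add op_scale)
qed

lemma op_bound: "\<exists>M\<ge>0. \<forall>f\<in>ell1 w. wnorm w (T f) \<le> M * wnorm w f"
proof -
  obtain M where M: "\<forall>f\<in>ell1 w. wnorm w (T f) \<le> M * wnorm w f"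
    using T by (auto simp: bounded_linear_op_def)
  have "wnorm w (T f) \<le> max M 0 * wnorm w f" if "f \<in> ell1 w" for f
    using M that mult_right_mono[OF max.cobounded1 wnorm_nonneg[OF that], of M 0] by fastforce
  then show ?thesis by (intro exI[of _ "max M 0"]) auto
qed

text \<open>The supremum in \<open>op_norm\<close> is taken in the reals, so it can be compared with
  its members only after boundedness is known.\<close>

lemma op_norm_ball_bdd: "bdd_above ((\<lambda>f. wnorm w (T f)) ` {f \<in> ell1 w. wnorm w f \<le> 1})"
proof -
  obtain M where M: "M \<ge> 0" "\<And>f. f \<in> ell1 w \<Longrightarrow> wnorm w (T f) \<le> M * wnorm w f"
    using op_bound by blast
  show ?thesis
  proof (intro bdd_aboveI2[of _ _ M])
    fix f assume "f \<in> {f \<in> ell1 w. wnorm w f \<le> 1}"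
    then show "wnorm w (T f) \<le> M"
      using M(2)[of f] mult_left_le[OF _ M(1), of "wnorm w f"] by auto
  qed
qed

lemma op_norm_bound:
  assumes f: "f \<in> ell1 w"
  shows "wnorm w (T f) \<le> op_norm w T * wnorm w f"
proof (cases "wnorm w f = 0")
  case True
  obtain M where "\<And>f. f \<in> ell1 w \<Longrightarrow> wnorm w (T f) \<le> M * wnorm w f"
    using op_bound by blast
  from this[OF f] True show ?thesis by simp
next
  case False
  then have pos: "wnorm w f > 0" using wnorm_nonneg[OF f] by simp
  let ?g = "\<lambda>n. (1 / wnorm w f) * f n"
  have "?g \<in> ell1 w" "wnorm w ?g \<le> 1"
    using ell1_scale[OF f, of "1 / wnorm w f"] pos by simp_all
  then have "wnorm w (T ?g) \<le> op_norm w T"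
    unfolding op_norm_def using op_norm_ball_bdd by (intro cSUP_upper) auto
  moreover have "wnorm w (T ?g) = wnorm w (T f) / wnorm w f"
    using op_scale[OF f, of "1 / wnorm w f"] ell1_scale(2)[OF op_ell1[OF f], of "1 / wnorm w f"] pos
    by simp
  ultimately have "wnorm w (T f) / wnorm w f \<le> op_norm w T" by simp
  with pos show ?thesis by (simp only: pos_divide_le_eq)
qed

lemma op_norm_attain:
  assumes "c < op_norm w T"
  obtains f where "f \<in> ell1 w" "wnorm w f \<le> 1" "c < wnorm w (T f)"
proof -
  have "\<exists>f\<in>{f \<in> ell1 w. wnorm w f \<le> 1}. c < wnorm w (T f)"
    using assms unfolding op_norm_def
    by (subst less_cSUP_iff[symmetric])
       (auto intro!: op_norm_ball_bdd exI[of _ "\<lambda>_. 0"] simp del: ell1_zero intro: ell1_zero)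
  then show ?thesis using that by blast
qed

text \<open>Of the two points \<open>x \<plusminus> r f\<close>, with \<open>f\<close> almost norming, one is mapped far away from \<open>0\<close>.\<close>

lemma op_norm_attain_translated:
  assumes x: "x \<in> ell1 w" and r: "r > 0" and c: "c < op_norm w T"
  shows "\<exists>d. d \<in> ell1 w \<and> wnorm w d \<le> r \<and> r * c < wnorm w (T (\<lambda>n. x n + d n))"
proof -
  obtain f where f: "f \<in> ell1 w" "wnorm w f \<le> 1" "c < wnorm w (T f)"
    using op_norm_attain[OF c] .
  define d where "d = (\<lambda>n. r * f n)"
  define d' where "d' = (\<lambda>n. -r * f n)"
  have d: "d \<in> ell1 w" "wnorm w d \<le> r" and d': "d' \<in> ell1 w" "wnorm w d' \<le> r"
    using ell1_scale[OF f(1), of r] ell1_scale[OF f(1), of "-r"] r f(2)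
    by (simp_all add: d_def d'_def)
  have le: "wnorm w (\<lambda>n. T (\<lambda>n. x n + d n) n - T (\<lambda>n. x n + d' n) n)
      \<le> wnorm w (T (\<lambda>n. x n + d n)) + wnorm w (T (\<lambda>n. x n + d' n))"
    by (intro ell1_diff op_ell1 ell1_add x d d')
  \<comment> \<open>The centre \<open>x\<close> cancels and \<open>2 * r * T f\<close> remains, so
    the two images cannot both have norm at most \<open>r * c\<close>.\<close>
  have eq: "(\<lambda>n. T (\<lambda>n. x n + d n) n - T (\<lambda>n. x n + d' n) n) = (\<lambda>n. (2 * r) * T f n)"
    by (subst op_add[OF x d(1)], subst op_add[OF x d'(1)])
       (use op_scale[OF f(1), of r] op_scale[OF f(1), of "-r"] in \<open>simp add: d_def d'_def algebra_simps\<close>)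
  have "wnorm w (\<lambda>n. (2 * r) * T f n) = 2 * r * wnorm w (T f)"
    using ell1_scale(2)[OF op_ell1[OF f(1)], of "2 * r"] r by simp
  with le have "2 * r * wnorm w (T f)
      \<le> wnorm w (T (\<lambda>n. x n + d n)) + wnorm w (T (\<lambda>n. x n + d' n))"
    by (simp only: eq)
  moreover have "r * c < r * wnorm w (T f)" using r f(3) by simp
  ultimately have "r * c < wnorm w (T (\<lambda>n. x n + d n)) \<or> r * c < wnorm w (T (\<lambda>n. x n + d' n))"
    by linarith
  then show ?thesis
  proof
    assume "r * c < wnorm w (T (\<lambda>n. x n + d n))"
    with d show ?thesis by (intro exI[of _ d] conjI)
  next
    assume "r * c < wnorm w (T (\<lambda>n. x n + d' n))"
    with d' show ?thesis by (intro exI[of _ d'] conjI)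
  qed
qed

end

text \<open>Sokal's proof of the uniform boundedness principle, which needs only that
  absolutely convergent series converge.\<close>

lemma uniform_boundedness:
  assumes T: "\<And>k. bounded_linear_op w (T k)"
    and bdd: "\<And>f. f \<in> ell1 w \<Longrightarrow> \<exists>M. \<forall>k. wnorm w (T k f) \<le> M"
  shows "\<exists>M. \<forall>k. op_norm w (T k) \<le> M"
proof (rule ccontr)
  assume "\<not> ?thesis"
  \<comment> \<open>The growth \<open>4 ^ j\<close> is matched with steps of length
    \<open>r j = (1 / 3) ^ j\<close>: the steps are summable, while the products
    \<open>(4 / 3) ^ j\<close> are unbounded.\<close>
  then have "\<forall>j. \<exists>k. op_norm w (T k) > 4 ^ j" by (meson not_less)
  then obtain \<sigma> where \<sigma>: "\<And>j. op_norm w (T (\<sigma> j)) > 4 ^ j" by metis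
  define R where "R j = T (\<sigma> j)" for j
  define r :: "nat \<Rightarrow> real" where "r j = (1 / 3) ^ j" for j
  have R: "bounded_linear_op w (R j)" and N: "op_norm w (R j) > 4 ^ j" for j
    using T \<sigma> by (auto simp: R_def)
  \<comment> \<open>The fraction \<open>2 / 3\<close> is below \<open>1\<close>, so that an almost
    norming step exists, and above the fraction \<open>1 / 2\<close> that is later lost to the tail.
    Fixing the step by choice allows \<open>x\<close> to be defined by primitive recursion.\<close>
  define D where "D x j = (SOME d. d \<in> ell1 w \<and> wnorm w d \<le> r j \<and>
      r j * (2 / 3 * op_norm w (R j)) < wnorm w (R j (\<lambda>n. x n + d n)))" for x j
  have D: "D x j \<in> ell1 w \<and> wnorm w (D x j) \<le> r j \<and>
      r j * (2 / 3 * op_norm w (R j)) < wnorm w (R j (\<lambda>n. x n + D x j n))"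
    if x: "x \<in> ell1 w" for x j
  proof -
    have "r j > 0" by (simp add: r_def)
    moreover have "0 < (4 :: real) ^ j" by simp
    with N[of j] have "2 / 3 * op_norm w (R j) < op_norm w (R j)" by linarith
    ultimately show ?thesis
      unfolding D_def by (rule someI_ex[OF op_norm_attain_translated[OF R x]])
  qed
  define x where "x = rec_nat (\<lambda>n. 0) (\<lambda>j y n. y n + D y j n)"
  have x_0: "x 0 = (\<lambda>n. 0)" and x_Suc: "x (Suc j) = (\<lambda>n. x j n + D (x j) j n)" for j
    by (simp_all add: x_def)
  have x: "x j \<in> ell1 w" for j
    by (induction j) (simp_all add: x_0 x_Suc ell1_add D)
  define d where "d j = D (x j) j" for j
  have d: "d j \<in> ell1 w" "wnorm w (d j) \<le> r j" for j
    using D x by (simp_all add: d_def)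
  have x_sum: "x j n = (\<Sum>i<j. d i n)" for j n
    by (induction j) (simp_all add: x_0 x_Suc d_def)
  have sr: "summable (\<lambda>i. r (i + j))" for j
    unfolding r_def power_add by (intro summable_mult2 summable_geometric) simp
  have sd: "summable (\<lambda>i. wnorm w (d (i + j)))" for j
    by (rule summable_comparison_test'[OF sr[of j], of 0]) (use d wnorm_nonneg in auto)
  define X where "X = (\<lambda>n. \<Sum>k. d k n)"
  have X: "X \<in> ell1 w"
    unfolding X_def using ell1_complete(1)[of d] d(1) sd[of 0] by simp
  have tail: "wnorm w (\<lambda>n. X n - x (Suc j) n) \<le> r j / 2" for j
  proof -
    have "X n - x (Suc j) n = (\<Sum>k. d (k + Suc j) n)" for n
      unfolding X_def x_sum using ell1_complete(3)[of d n] d(1) sd[of 0]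
      by (subst suminf_minus_initial_segment) simp_all
    then have "wnorm w (\<lambda>n. X n - x (Suc j) n) \<le> (\<Sum>k. wnorm w (d (k + Suc j)))"
      using ell1_complete(2)[OF d(1) sd[of "Suc j"]] by simp
    also have "\<dots> \<le> (\<Sum>k. r (k + Suc j))"
      by (intro suminf_le d sd sr)
    also have "\<dots> = r (Suc j) * (\<Sum>k. (1 / 3) ^ k)"
      unfolding r_def power_add mult.commute[of "(1 / 3) ^ _" "(1 / 3) ^ Suc j"]
      by (rule suminf_mult) (simp add: summable_geometric)
    also have "\<dots> = r j / 2"
      by (simp add: r_def suminf_geometric)
    finally show ?thesis .
  qed
  obtain M where M: "\<And>k. wnorm w (T k X) \<le> M" using bdd[OF X] by blast
  \<comment> \<open>The image of \<open>x (Suc j)\<close> has norm above \<open>2 / 3\<close> of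
    \<open>r j * op_norm w (R j)\<close>; passing from \<open>x (Suc j)\<close> to the limit
    \<open>X\<close> costs at most half of that product, which leaves \<open>1 / 6\<close>.\<close>
  have "r j * (op_norm w (R j) / 6) < M" for j
  proof -
    have "r j * (2 / 3 * op_norm w (R j)) < wnorm w (R j (x (Suc j)))"
      using D[OF x] by (simp add: x_Suc)
    also have "\<dots> \<le> wnorm w (R j X) + wnorm w (\<lambda>n. R j (x (Suc j)) n - R j X n)"
      by (intro wnorm_le_diff op_ell1[OF R] x X)
    also have "(\<lambda>n. R j (x (Suc j)) n - R j X n) = R j (\<lambda>n. x (Suc j) n - X n)"
      by (rule op_diff[OF R x X, symmetric])
    also have "wnorm w \<dots> \<le> op_norm w (R j) * wnorm w (\<lambda>n. x (Suc j) n - X n)"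
      by (intro op_norm_bound R ell1_diff x X)
    also have "\<dots> \<le> op_norm w (R j) * (r j / 2)"
    proof (rule mult_left_mono)
      show "wnorm w (\<lambda>n. x (Suc j) n - X n) \<le> r j / 2"
        using tail[of j] by (subst wnorm_minus_commute)
      have "0 < (4 :: real) ^ j" by simp
      with N[of j] show "0 \<le> op_norm w (R j)" by linarith
    qed
    also have "wnorm w (R j X) \<le> M" using M by (simp add: R_def)
    finally show ?thesis by (simp add: algebra_simps)
  qed
  moreover have "(4 / 3) ^ j / 6 \<le> r j * (op_norm w (R j) / 6)" for j
    using mult_left_mono[OF less_imp_le[OF N[of j]], of "r j"]
    by (simp add: r_def power_divide)
  ultimately have "(4 / 3 :: real) ^ j / 6 < M" for j
    by (rule le_less_trans[rotated])
  then have "(4 / 3 :: real) ^ j < 6 * M" for j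
    by (simp add: divide_less_eq mult.commute)
  moreover obtain j where "(4 / 3 :: real) ^ j > 6 * M"
    using real_arch_pow[of "4 / 3" "6 * M"] by auto
  ultimately show False by (meson less_asym)
qed

section \<open>Operator bounds read off from the unit sequences\<close>

lemma wnorm_op_trunc_le:
  assumes "bounded_linear_op w T"
  shows "wnorm w (T (trunc N f)) \<le> (\<Sum>m=1..N. \<bar>f m\<bar> * wnorm w (T (unit_seq m)))"
proof -
  have T: "T (unit_seq m) \<in> ell1 w" if "m \<ge> 1" for m
    using that by (intro op_ell1[OF assms] unit_seq_ell1)
  have "T (trunc N f) = (\<lambda>n. \<Sum>m=1..N. f m * T (unit_seq m) n)"
    unfolding trunc_def by (rule op_sum[OF assms]) (auto intro: unit_seq_ell1)
  then have "wnorm w (T (trunc N f)) \<le> (\<Sum>m=1..N. wnorm w (\<lambda>n. f m * T (unit_seq m) n))"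
    using ell1_sum[of "{1..N}" "\<lambda>m n. f m * T (unit_seq m) n"] T by (auto intro: ell1_scale)
  also have "\<dots> = (\<Sum>m=1..N. \<bar>f m\<bar> * wnorm w (T (unit_seq m)))"
    by (intro sum.cong refl ell1_scale T) simp
  finally show ?thesis .
qed

lemma wnorm_op_le_trunc:
  assumes "bounded_linear_op w T" "f \<in> ell1 w"
  shows "wnorm w (T f) \<le> wnorm w (T (trunc N f)) + wnorm w (T (\<lambda>n. f n - trunc N f n))"
  using wnorm_le_diff[OF op_ell1[OF assms] op_ell1[OF assms(1) trunc_ell1]]
  by (simp add: op_diff[OF assms trunc_ell1])

text \<open>On truncations the triangle inequality gives the constant \<open>c\<close>. The
  remainder is only controlled by some bound \<open>M\<close> of the operator, but its norm tends to
  \<open>0\<close>, so \<open>M\<close> disappears in the limit.\<close>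

lemma op_bound_from_units:
  assumes T: "bounded_linear_op w T" and f: "f \<in> ell1 w"
    and le: "\<And>n. n \<ge> 1 \<Longrightarrow> wnorm w (T (unit_seq n)) \<le> c * w n"
  shows "wnorm w (T f) \<le> c * wnorm w f"
proof -
  obtain M where M: "M \<ge> 0" "\<And>f. f \<in> ell1 w \<Longrightarrow> wnorm w (T f) \<le> M * wnorm w f"
    using op_bound[OF T] by blast
  have "wnorm w (T f)
      \<le> c * (\<Sum>i<N. w (i + 1) * \<bar>f (i + 1)\<bar>) + M * wnorm w (\<lambda>n. f n - trunc N f n)" for N
  proof -
    have "wnorm w (T (trunc N f)) \<le> (\<Sum>m=1..N. \<bar>f m\<bar> * wnorm w (T (unit_seq m)))"
      by (rule wnorm_op_trunc_le[OF T])
    also have "\<dots> \<le> (\<Sum>m=1..N. \<bar>f m\<bar> * (c * w m))"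
      by (intro sum_mono mult_left_mono le) auto
    also have "\<dots> = (\<Sum>i<N. c * (w (i + 1) * \<bar>f (i + 1)\<bar>))"
      by (rule sum.reindex_bij_witness[of _ "\<lambda>i. i + 1" "\<lambda>i. i - 1"]) auto
    finally show ?thesis
      using wnorm_op_le_trunc[OF T f, of N] M(2)[OF ell1_diff(1)[OF f trunc_ell1[of N f]]]
      by (simp add: sum_distrib_left)
  qed
  moreover have "(\<lambda>N. c * (\<Sum>i<N. w (i + 1) * \<bar>f (i + 1)\<bar>)
      + M * wnorm w (\<lambda>n. f n - trunc N f n)) \<longlonglongrightarrow> c * wnorm w f + M * 0"
    using wnorm_sums[OF f] by (intro tendsto_intros trunc_tendsto[OF f]) (simp add: sums_def)
  ultimately show ?thesis
    by (intro LIMSEQ_le_const[of _ "c * wnorm w f"]) auto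
qed

end

section \<open>Orbits of semigroups\<close>

locale weighted_semigroup = weight +
  fixes S :: "real \<Rightarrow> (nat \<Rightarrow> real) \<Rightarrow> nat \<Rightarrow> real"
  assumes C0: "C0_semigroup w S"
begin

lemma S_op: "t \<ge> 0 \<Longrightarrow> bounded_linear_op w (S t)"
  and S_0: "f \<in> ell1 w \<Longrightarrow> S 0 f = f"
  and S_add: "s \<ge> 0 \<Longrightarrow> t \<ge> 0 \<Longrightarrow> f \<in> ell1 w \<Longrightarrow> S (s + t) f = S s (S t f)"
  and S_tendsto: "f \<in> ell1 w \<Longrightarrow> ((\<lambda>t. wnorm w (\<lambda>n. S t f n - f n)) \<longlongrightarrow> 0) (at_right 0)"
  using C0 by (auto simp: C0_semigroup_def)

lemma S_ell1: "t \<ge> 0 \<Longrightarrow> f \<in> ell1 w \<Longrightarrow> S t f \<in> ell1 w"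
  by (rule op_ell1[OF S_op])

text \<open>Otherwise there are times \<open>\<tau> k\<close> tending to \<open>0\<close> at which
  the operators have unbounded norms, although strong continuity at \<open>0\<close> keeps every
  single orbit bounded along these times. This contradicts
  \<open>uniform_boundedness\<close>.\<close>

lemma locally_bounded:
  obtains \<delta> M where "\<delta> > 0" "M \<ge> 0"
    "\<And>t f. 0 \<le> t \<Longrightarrow> t \<le> \<delta> \<Longrightarrow> f \<in> ell1 w \<Longrightarrow> wnorm w (S t f) \<le> M * wnorm w f"
proof -
  have "\<exists>\<delta>>0. \<exists>M\<ge>0. \<forall>t f. 0 \<le> t \<and> t \<le> \<delta> \<and> f \<in> ell1 w \<longrightarrow> wnorm w (S t f) \<le> M * wnorm w f"
  proof (rule ccontr)
    assume neg: "\<not> ?thesis"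
    have "\<exists>t f. 0 \<le> t \<and> t \<le> inverse (real (Suc k)) \<and> f \<in> ell1 w \<and>
        real (Suc k) * wnorm w f < wnorm w (S t f)" for k
    proof (rule ccontr)
      assume "\<not> ?thesis"
      then have "\<forall>t f. 0 \<le> t \<and> t \<le> inverse (real (Suc k)) \<and> f \<in> ell1 w \<longrightarrow>
          wnorm w (S t f) \<le> real (Suc k) * wnorm w f"
        by (simp only: not_le[symmetric]) blast
      moreover have "inverse (real (Suc k)) > 0" "real (Suc k) \<ge> 0" by simp_all
      ultimately show False using neg by blast
    qed
    then obtain \<tau> \<phi> where \<tau>: "\<And>k. 0 \<le> \<tau> k" "\<And>k. \<tau> k \<le> inverse (real (Suc k))"
      and \<phi>: "\<And>k. \<phi> k \<in> ell1 w" "\<And>k. real (Suc k) * wnorm w (\<phi> k) < wnorm w (S (\<tau> k) (\<phi> k))"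
      by metis
    \<comment> \<open>Strong continuity is a limit over positive times. Time \<open>0\<close> cannot
      occur, since there the choice of \<open>\<phi> k\<close> would make its norm smaller than
      itself.\<close>
    have pos: "\<tau> k > 0" for k
    proof (rule ccontr)
      assume "\<not> ?thesis"
      with \<tau>(1)[of k] have "\<tau> k = 0" by simp
      with \<phi>[of k] S_0[OF \<phi>(1)[of k]] have "real k * wnorm w (\<phi> k) < 0"
        by (simp add: algebra_simps)
      with wnorm_nonneg[OF \<phi>(1)[of k]] show False by (simp add: mult_less_0_iff)
    qed
    have "\<tau> \<longlonglongrightarrow> 0"
      by (rule tendsto_sandwich[OF _ _ tendsto_const LIMSEQ_inverse_real_of_nat])
         (simp_all only: \<tau> eventually_sequentiallyI)
    then have lim: "filterlim \<tau> (at_right 0) sequentially"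
      by (rule tendsto_imp_filterlim_at_right) (simp add: pos)
    have "\<exists>M. \<forall>k. wnorm w (S (\<tau> k) f) \<le> M" if f: "f \<in> ell1 w" for f
    proof -
      have "(\<lambda>k. wnorm w (\<lambda>n. S (\<tau> k) f n - f n)) \<longlonglongrightarrow> 0"
        by (rule filterlim_compose[OF S_tendsto[OF f] lim])
      then have "Bseq (\<lambda>k. wnorm w (\<lambda>n. S (\<tau> k) f n - f n))"
        using convergentI convergent_imp_Bseq by blast
      then obtain B where B: "\<And>k. norm (wnorm w (\<lambda>n. S (\<tau> k) f n - f n)) \<le> B"
        by (auto simp: Bseq_def)
      have "wnorm w (S (\<tau> k) f) \<le> wnorm w f + B" for k
        using wnorm_le_diff[OF S_ell1[OF \<tau>(1) f] f, of k] B[of k] by simp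
      then show ?thesis by blast
    qed
    with uniform_boundedness[of "\<lambda>k. S (\<tau> k)"] S_op \<tau>(1)
    obtain M where M: "\<And>k. op_norm w (S (\<tau> k)) \<le> M" by blast
    obtain k where k: "M < real k" using reals_Archimedean2 by blast
    have "wnorm w (S (\<tau> k) (\<phi> k)) \<le> op_norm w (S (\<tau> k)) * wnorm w (\<phi> k)"
      by (intro op_norm_bound S_op \<tau> \<phi>)
    also have "\<dots> \<le> real (Suc k) * wnorm w (\<phi> k)"
      using M[of k] k by (intro mult_right_mono wnorm_nonneg \<phi>) simp
    finally show False using \<phi>(2)[of k] by simp
  qed
  then show ?thesis using that by blast
qed

text \<open>Write \<open>S (t - h)\<close> as \<open>S (t - \<epsilon>)\<close> after
  \<open>S (\<epsilon> - h)\<close>: the first is one fixed bounded operator, the second falls under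
  local boundedness near \<open>0\<close>. The left derivative of an orbit needs this uniformity in
  \<open>h\<close>.\<close>

lemma locally_bounded_left:
  assumes t: "t > 0"
  obtains \<delta> M where "\<delta> > 0" "\<delta> \<le> t" "M \<ge> 0"
    "\<And>h f. 0 \<le> h \<Longrightarrow> h \<le> \<delta> \<Longrightarrow> f \<in> ell1 w \<Longrightarrow> wnorm w (S (t - h) f) \<le> M * wnorm w f"
proof -
  obtain \<delta> M where \<delta>: "\<delta> > 0" and M: "M \<ge> 0"
    "\<And>t f. 0 \<le> t \<Longrightarrow> t \<le> \<delta> \<Longrightarrow> f \<in> ell1 w \<Longrightarrow> wnorm w (S t f) \<le> M * wnorm w f"
    using locally_bounded by blast
  define \<epsilon> where "\<epsilon> = min \<delta> t"
  have \<epsilon>: "\<epsilon> > 0" "\<epsilon> \<le> t" "\<epsilon> \<le> \<delta>" using \<delta> t by (auto simp: \<epsilon>_def)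
  obtain K where K: "K \<ge> 0" "\<And>f. f \<in> ell1 w \<Longrightarrow> wnorm w (S (t - \<epsilon>) f) \<le> K * wnorm w f"
    using op_bound[OF S_op[of "t - \<epsilon>"]] \<epsilon> by auto
  have "wnorm w (S (t - h) f) \<le> (K * M) * wnorm w f" if "0 \<le> h" "h \<le> \<epsilon>" "f \<in> ell1 w" for h f
  proof -
    have "wnorm w (S (t - h) f) = wnorm w (S (t - \<epsilon>) (S (\<epsilon> - h) f))"
      using S_add[of "t - \<epsilon>" "\<epsilon> - h" f] \<epsilon> that by simp
    also have "\<dots> \<le> K * wnorm w (S (\<epsilon> - h) f)"
      using that by (intro K S_ell1) auto
    also have "\<dots> \<le> K * (M * wnorm w f)"
      using that \<epsilon> by (intro mult_left_mono K M) auto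
    finally show ?thesis by simp
  qed
  then show ?thesis using that[of \<epsilon> "K * M"] \<epsilon> K(1) M(1) by simp
qed

section \<open>Regularity of the coordinates of orbits\<close>

lemma orbit_tendsto_0:
  assumes f: "f \<in> ell1 w" and k: "k \<ge> 1"
  shows "((\<lambda>t. S t f k) \<longlongrightarrow> f k) (at_right 0)"
proof -
  have "((\<lambda>t. S t f k - f k) \<longlongrightarrow> 0) (at_right 0)"
  proof (rule Lim_null_comparison)
    show "((\<lambda>t. wnorm w (\<lambda>n. S t f n - f n) / w k) \<longlongrightarrow> 0) (at_right 0)"
      using tendsto_divide[OF S_tendsto[OF f] tendsto_const, of "w k"] weight_pos[OF k] by simp
    have "norm (S t f k - f k) \<le> wnorm w (\<lambda>n. S t f n - f n) / w k" if "t > 0" for t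
      using coord_le_wnorm[OF ell1_diff(1)[OF S_ell1[OF _ f] f] k, of t] that weight_pos[OF k]
      by (simp add: field_simps)
    then show "\<forall>\<^sub>F t in at_right 0. norm (S t f k - f k) \<le> wnorm w (\<lambda>n. S t f n - f n) / w k"
      by (auto simp: eventually_at_right_less intro: eventually_mono[OF eventually_at_right_less])
  qed
  then show ?thesis by (simp add: LIM_zero_iff)
qed

text \<open>Both one-sided difference quotients at \<open>t\<close> are reduced to the one at time
  \<open>0\<close>: on the right by applying \<open>S t\<close>, on the left by applying
  \<open>S (t - h)\<close>, whose bound must then be uniform in small \<open>h\<close>.\<close>

lemma orbit_has_derivative:
  assumes fg: "(f, g) \<in> generator w S" and k: "k \<ge> 1" and t: "t > 0"
  shows "((\<lambda>s. S s f k) has_real_derivative S t g k) (at t)"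
proof -
  have f: "f \<in> ell1 w" and g: "g \<in> ell1 w"
    and lim: "((\<lambda>h. wnorm w (\<lambda>n. (S h f n - f n) / h - g n)) \<longlongrightarrow> 0) (at_right 0)"
    using fg by (auto simp: generator_def)
  \<comment> \<open>The error of the difference quotient at time \<open>0\<close>, written with the
    factor \<open>1 / h\<close> so that the linearity rules apply.\<close>
  define z where "z h = (\<lambda>n. (1 / h) * (S h f n - f n) - g n)" for h
  have z: "z h \<in> ell1 w" if "h > 0" for h
    unfolding z_def using that by (intro ell1_diff ell1_scale S_ell1 f g) simp
  have z_lim: "((\<lambda>h. wnorm w (z h)) \<longlongrightarrow> 0) (at_right 0)"
    using lim by (simp add: z_def)
  have Tz: "T (z h) = (\<lambda>n. (T (S h f) n - T f n) / h - T g n)"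
    if "h > 0" "bounded_linear_op w T" for h T
  proof -
    have h: "S h f \<in> ell1 w" using that by (intro S_ell1 f) simp
    then have d: "(\<lambda>n. S h f n - f n) \<in> ell1 w" by (intro ell1_diff f)
    show ?thesis
      unfolding z_def op_diff[OF that(2) ell1_scale(1)[OF d] g] op_scale[OF that(2) d]
        op_diff[OF that(2) h f] by simp
  qed
  have coord: "\<bar>T x k\<bar> \<le> M / w k * wnorm w x"
    if "T x \<in> ell1 w" "wnorm w (T x) \<le> M * wnorm w x" for T M x
    using coord_le_wnorm[OF that(1) k] that(2) weight_pos[OF k] by (simp add: field_simps)
  have right: "((\<lambda>h. (S (t + h) f k - S t f k) / h) \<longlongrightarrow> S t g k) (at_right 0)"
  proof -
    obtain M where M: "M \<ge> 0" "\<And>f. f \<in> ell1 w \<Longrightarrow> wnorm w (S t f) \<le> M * wnorm w f"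
      using op_bound[OF S_op[of t]] t by auto
    have "norm ((S (t + h) f k - S t f k) / h - S t g k) \<le> M / w k * wnorm w (z h)" if "h > 0" for h
    proof -
      have "(S (t + h) f k - S t f k) / h - S t g k = S t (z h) k"
        using Tz[OF that S_op[of t]] S_add[of t h f] t that f by simp
      then show ?thesis using coord[of "S t" "z h" M] M z[OF that] t by (simp add: S_ell1)
    qed
    then have "\<forall>\<^sub>F h in at_right 0. norm ((S (t + h) f k - S t f k) / h - S t g k)
        \<le> M / w k * wnorm w (z h)"
      by (auto intro: eventually_mono[OF eventually_at_right_less])
    moreover have "((\<lambda>h. M / w k * wnorm w (z h)) \<longlongrightarrow> 0) (at_right 0)"
      using tendsto_mult_left[OF z_lim, of "M / w k"] by simp
    ultimately show ?thesis
      by (subst LIM_zero_iff[symmetric]) (rule Lim_null_comparison)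
  qed
  have left: "((\<lambda>h. (S (t - h) f k - S t f k) / (- h)) \<longlongrightarrow> S t g k) (at_right 0)"
  proof -
    obtain \<delta> M where \<delta>: "\<delta> > 0" "\<delta> \<le> t" and M: "M \<ge> 0"
      "\<And>h f. 0 \<le> h \<Longrightarrow> h \<le> \<delta> \<Longrightarrow> f \<in> ell1 w \<Longrightarrow> wnorm w (S (t - h) f) \<le> M * wnorm w f"
      using locally_bounded_left[OF t] by blast
    have "norm ((S (t - h) f k - S t f k) / (- h) - S t g k)
        \<le> M / w k * (wnorm w (z h) + wnorm w (\<lambda>n. S h g n - g n))" if h: "0 < h" "h < \<delta>" for h
    proof -
      have th: "t - h \<ge> 0" and op: "bounded_linear_op w (S (t - h))"
        using h \<delta> by (auto intro: S_op)
      have hg: "S h g \<in> ell1 w" and y: "(\<lambda>n. S h g n - g n) \<in> ell1 w"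
        using h by (auto intro!: ell1_diff S_ell1 g)
      \<comment> \<open>With both factorizations the left quotient becomes \<open>S (t - h)\<close>
        applied to \<open>z h + g\<close>, from which \<open>S (t - h)\<close> applied to
        \<open>S h g\<close> is subtracted. The second error is small by strong continuity at
        \<open>g\<close>.\<close>
      have "S t f = S (t - h) (S h f)" "S t g = S (t - h) (S h g)"
        using S_add[of "t - h" h] th h f g by simp_all
      then have "(S (t - h) f k - S t f k) / (- h) - S t g k
          = S (t - h) (z h) k - S (t - h) (\<lambda>n. S h g n - g n) k"
        using h by (simp add: Tz[OF h(1) op] op_diff[OF op hg g] field_simps)
      moreover have "\<bar>S (t - h) (z h) k\<bar> \<le> M / w k * wnorm w (z h)"
        using h th z by (intro coord M S_ell1) auto
      moreover have "\<bar>S (t - h) (\<lambda>n. S h g n - g n) k\<bar> \<le> M / w k * wnorm w (\<lambda>n. S h g n - g n)"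
        using h th y by (intro coord M S_ell1) auto
      ultimately show ?thesis by (simp add: distrib_left)
    qed
    then have "\<forall>\<^sub>F h in at_right 0. norm ((S (t - h) f k - S t f k) / (- h) - S t g k)
        \<le> M / w k * (wnorm w (z h) + wnorm w (\<lambda>n. S h g n - g n))"
      using \<delta>(1) by (auto simp: eventually_at_right_field)
    moreover have "((\<lambda>h. M / w k * (wnorm w (z h) + wnorm w (\<lambda>n. S h g n - g n))) \<longlongrightarrow> 0)
        (at_right 0)"
      using tendsto_mult_left[OF tendsto_add[OF z_lim S_tendsto[OF g]], of "M / w k"] by simp
    ultimately show ?thesis
      by (subst LIM_zero_iff[symmetric]) (rule Lim_null_comparison)
  qed
  show ?thesis
    unfolding DERIV_def
    by (rule filterlim_split_at) (use left right in \<open>simp_all add: filterlim_at_left_to_right\<close>)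
qed

lemma orbit_continuous:
  assumes fg: "(f, g) \<in> generator w S" and k: "k \<ge> 1"
  shows "continuous_on {0..} (\<lambda>s. S s f k)"
  unfolding continuous_on_eq_continuous_within
proof
  fix t :: real assume "t \<in> {0..}"
  then consider "t = 0" | "t > 0" by force
  then show "continuous (at t within {0..}) (\<lambda>s. S s f k)"
  proof cases
    case 1
    have "f \<in> ell1 w" using fg by (simp add: generator_def)
    then show ?thesis
      using orbit_tendsto_0[OF _ k, of f] 1
      by (simp add: continuous_within at_within_Ici_at_right S_0)
  next
    case 2
    show ?thesis
      by (rule continuous_at_imp_continuous_at_within[OF DERIV_isCont[OF orbit_has_derivative[OF fg k 2]]])
  qed
qed

end

section \<open>The fragmentation semigroup\<close>

text \<open>With the integrating factor, \<open>exp (c * s) * d s\<close> is nondecreasing, hence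
  stays above its value at \<open>0\<close>. Derivatives are asked for at positive times and mere
  continuity at \<open>0\<close>, which is what the orbits provide.\<close>

lemma linear_differential_inequality:
  fixes d D :: "real \<Rightarrow> real"
  assumes cont: "continuous_on {0..} d"
    and der: "\<And>s. s > 0 \<Longrightarrow> (d has_real_derivative D s) (at s)"
    and ineq: "\<And>s. s > 0 \<Longrightarrow> - c * d s \<le> D s"
    and "d 0 \<ge> 0" "t \<ge> 0"
  shows "d t \<ge> 0"
proof -
  have "exp (c * 0) * d 0 \<le> exp (c * t) * d t"
  proof (rule DERIV_nonneg_imp_increasing_open[OF \<open>t \<ge> 0\<close>])
    fix s assume "0 < s" "s < t"
    then have "((\<lambda>s. exp (c * s) * d s) has_real_derivative exp (c * s) * (c * d s + D s)) (at s)"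
      by (auto intro!: derivative_eq_intros der simp: algebra_simps)
    moreover have "0 \<le> exp (c * s) * (c * d s + D s)"
      using ineq[OF \<open>0 < s\<close>] by simp
    ultimately show "\<exists>y. ((\<lambda>s. exp (c * s) * d s) has_real_derivative y) (at s) \<and> y \<ge> 0" by blast
  qed (auto intro!: continuous_intros continuous_on_subset[OF cont])
  with \<open>d 0 \<ge> 0\<close> have "0 \<le> exp (c * t) * d t" by simp
  then show ?thesis by (simp add: zero_le_mult_iff)
qed

lemma exp_neg_tendsto:
  fixes c :: real
  assumes "c > 0"
  shows "((\<lambda>t. exp (- c * t)) \<longlongrightarrow> 0) at_top"
  by (rule filterlim_compose[OF exp_at_bot])
     (rule filterlim_tendsto_neg_mult_at_bot[OF tendsto_const _ filterlim_ident], use assms in simp)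

section \<open>Unit sequences in the generator and their triangular system\<close>

locale fragmentation = weight +
  fixes a :: "nat \<Rightarrow> real" and b :: "nat \<Rightarrow> nat \<Rightarrow> real"
    and S :: "real \<Rightarrow> (nat \<Rightarrow> real) \<Rightarrow> nat \<Rightarrow> real"
  assumes a_nonneg: "n \<ge> 1 \<Longrightarrow> 0 \<le> a n"
    and b_nonneg: "n \<ge> 1 \<Longrightarrow> j \<ge> 1 \<Longrightarrow> 0 \<le> b n j"
    and frag: "frag_semigroup w a b S"
begin

sublocale weighted_semigroup w S
  by unfold_locales (use frag in \<open>simp add: frag_semigroup_def\<close>)

text \<open>The series of \<open>op_B\<close> for row \<open>i\<close> runs over indices above
  \<open>i\<close>, so it meets the single nonzero entry of \<open>unit_seq n\<close> exactly when
  \<open>i < n\<close>. Thus only finitely many rows contribute and the image is finitely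
  supported.\<close>

lemma unit_seq_generator:
  assumes n: "n \<ge> 1"
  shows "(unit_seq n, \<lambda>i. - a n * unit_seq n i + (\<Sum>m=1..<n. a n * b m n * unit_seq m i)) \<in> generator w S"
    (is "(_, ?g) \<in> _")
proof -
  let ?B = "\<lambda>i. \<Sum>m=1..<n. a n * b m n * unit_seq m i"
  have e: "unit_seq n \<in> ell1 w" using n by (rule unit_seq_ell1)
  have A_eq: "(\<lambda>i. a i * unit_seq n i) = (\<lambda>i. a n * unit_seq n i)"
    by (auto simp: unit_seq_def)
  have A: "(unit_seq n, \<lambda>i. - a n * unit_seq n i) \<in> op_A w a"
    using e ell1_scale(1)[OF e, of "a n"] by (simp add: op_A_def A_eq fun_eq_iff) (simp add: unit_seq_def)
  have B_ell1: "?B \<in> ell1 w"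
    by (rule conjunct1[OF ell1_sum]) (auto intro!: ell1_scale(1) unit_seq_ell1)
  have B_sums: "(\<lambda>j. a (i + 1 + j) * b i (i + 1 + j) * unit_seq n (i + 1 + j)) sums ?B i"
    if "i \<ge> 1" for i
  proof (cases "i < n")
    case True
    have "?B i = a n * b i n"
      using that True by (simp add: unit_seq_def if_distrib sum.delta cong: if_cong)
    \<comment> \<open>The summation index is shifted: \<open>i + 1 + j = n\<close> holds exactly for
      \<open>j = n - i - 1\<close>.\<close>
    moreover have "(\<lambda>j. if j = n - i - 1 then a n * b i n else 0) sums (a n * b i n)"
      using sums_single[of "n - i - 1" "\<lambda>_. a n * b i n"] by simp
    moreover have "(\<lambda>j. a (i + 1 + j) * b i (i + 1 + j) * unit_seq n (i + 1 + j))
        = (\<lambda>j. if j = n - i - 1 then a n * b i n else 0)"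
      using True by (auto simp: unit_seq_def fun_eq_iff)
    ultimately show ?thesis by simp
  next
    case False
    then have "?B i = 0" by (intro sum.neutral) (auto simp: unit_seq_def)
    moreover have "(\<lambda>j. a (i + 1 + j) * b i (i + 1 + j) * unit_seq n (i + 1 + j)) = (\<lambda>j. 0)"
      using False by (auto simp: unit_seq_def fun_eq_iff)
    ultimately show ?thesis by simp
  qed
  have "(unit_seq n, ?B) \<in> op_B w a b"
    using e B_ell1 B_sums by (simp add: op_B_def)
  with A have mem: "(unit_seq n, ?g) \<in> op_plus (op_A w a) (op_B w a b)"
    unfolding op_plus_def by blast
  have g: "?g \<in> ell1 w"
    by (intro ell1_add(1) ell1_scale(1) e B_ell1)
  \<comment> \<open>Constant approximating sequences show that a pair in the operator lies in its
    closure.\<close>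
  have "(unit_seq n, ?g) \<in> op_closure w (op_plus (op_A w a) (op_B w a b))"
    unfolding op_closure_def case_prod_unfold mem_Collect_eq fst_conv snd_conv
    using mem e g by (intro conjI exI[of _ "\<lambda>k. unit_seq n"] exI[of _ "\<lambda>k. ?g"]) simp_all
  then show ?thesis using frag by (simp add: frag_semigroup_def)
qed

lemma orbit_unit_continuous:
  "n \<ge> 1 \<Longrightarrow> k \<ge> 1 \<Longrightarrow> continuous_on {0..} (\<lambda>s. S s (unit_seq n) k)"
  by (rule orbit_continuous[OF unit_seq_generator])

text \<open>The backward equation: \<open>S t\<close> is applied to \<open>G e\<^sub>n\<close> rather than \<open>G\<close> to \<open>S t e\<^sub>n\<close>,
  so that the system for \<open>S t e\<^sub>n\<close>, \<open>n = 1, 2, \<dots>\<close>, is triangular and can be solved by induction.\<close>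

lemma orbit_unit_derivative:
  assumes n: "n \<ge> 1" and k: "k \<ge> 1" and t: "t > 0"
  shows "((\<lambda>s. S s (unit_seq n) k) has_real_derivative
    - a n * S t (unit_seq n) k + (\<Sum>m=1..<n. a n * b m n * S t (unit_seq m) k)) (at t)"
proof -
  have op: "bounded_linear_op w (S t)" using t by (intro S_op) simp
  have B_ell1: "(\<lambda>i. \<Sum>m=1..<n. a n * b m n * unit_seq m i) \<in> ell1 w"
    by (rule conjunct1[OF ell1_sum]) (auto intro!: ell1_scale(1) unit_seq_ell1)
  have B: "S t (\<lambda>i. \<Sum>m=1..<n. a n * b m n * unit_seq m i)
      = (\<lambda>i. \<Sum>m=1..<n. a n * b m n * S t (unit_seq m) i)"
    by (rule op_sum[OF op]) (auto intro: unit_seq_ell1)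
  have "S t (\<lambda>i. - a n * unit_seq n i + (\<Sum>m=1..<n. a n * b m n * unit_seq m i))
      = (\<lambda>i. - a n * S t (unit_seq n) i + (\<Sum>m=1..<n. a n * b m n * S t (unit_seq m) i))"
    by (simp only: op_add[OF op ell1_scale(1)[OF unit_seq_ell1[OF n]] B_ell1]
        op_scale[OF op unit_seq_ell1[OF n]] B)
  with orbit_has_derivative[OF unit_seq_generator[OF n] k t] show ?thesis by simp
qed

section \<open>Positivity and the diagonal lower bound\<close>

lemma orbit_unit_nonneg:
  "n \<ge> 1 \<Longrightarrow> k \<ge> 1 \<Longrightarrow> t \<ge> 0 \<Longrightarrow> 0 \<le> S t (unit_seq n) k"
proof (induction n arbitrary: t rule: less_induct)
  case (less n)
  show ?case
  proof (rule linear_differential_inequality[where d = "\<lambda>s. S s (unit_seq n) k" and c = "a n",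
        OF orbit_unit_continuous orbit_unit_derivative])
    \<comment> \<open>The gain terms involve smaller unit sequences only, so they are nonnegative by
      induction and may be dropped.\<close>
    fix s :: real assume "s > 0"
    then have "0 \<le> (\<Sum>m=1..<n. a n * b m n * S s (unit_seq m) k)"
      using less by (intro sum_nonneg mult_nonneg_nonneg a_nonneg b_nonneg) auto
    then show "- a n * S s (unit_seq n) k
        \<le> - a n * S s (unit_seq n) k + (\<Sum>m=1..<n. a n * b m n * S s (unit_seq m) k)" by simp
  qed (use less.prems in \<open>auto simp: S_0 unit_seq_ell1\<close>, simp add: unit_seq_def)
qed

text \<open>Without the nonnegative gain terms the equation is solved by
  \<open>exp (- a n * t)\<close>. Both functions start at \<open>1\<close>, so their difference
  stays nonnegative by comparison.\<close>

lemma orbit_unit_diagonal: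
  assumes n: "n \<ge> 1" and "t \<ge> 0"
  shows "exp (- a n * t) \<le> S t (unit_seq n) n"
proof -
  define D where "D s = - a n * S s (unit_seq n) n + (\<Sum>m=1..<n. a n * b m n * S s (unit_seq m) n)" for s
  have "0 \<le> S t (unit_seq n) n - exp (- a n * t)"
  proof (rule linear_differential_inequality[where d = "\<lambda>s. S s (unit_seq n) n - exp (- a n * s)"
      and c = "a n" and D = "\<lambda>s. D s + a n * exp (- a n * s)"])
    fix s :: real assume s: "s > 0"
    show "((\<lambda>s. S s (unit_seq n) n - exp (- a n * s)) has_real_derivative D s + a n * exp (- a n * s)) (at s)"
      unfolding D_def by (auto intro!: derivative_eq_intros orbit_unit_derivative n s)
    have "0 \<le> (\<Sum>m=1..<n. a n * b m n * S s (unit_seq m) n)"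
      using n s by (intro sum_nonneg mult_nonneg_nonneg a_nonneg b_nonneg orbit_unit_nonneg) auto
    then show "- a n * (S s (unit_seq n) n - exp (- a n * s)) \<le> D s + a n * exp (- a n * s)"
      by (simp add: D_def algebra_simps)
  qed (use assms in \<open>auto intro!: continuous_intros orbit_unit_continuous simp: S_0 unit_seq_ell1\<close>,
       simp add: unit_seq_def)
  then show ?thesis by simp
qed

section \<open>Norm bounds for the orbits\<close>

lemma wnorm_orbit_unit_ge:
  assumes "n \<ge> 1" "t \<ge> 0"
  shows "w n * exp (- a n * t) \<le> wnorm w (S t (unit_seq n))"
proof -
  have "w n * exp (- a n * t) \<le> w n * \<bar>S t (unit_seq n) n\<bar>"
    using orbit_unit_diagonal[OF assms] weight_pos[OF assms(1)] by (intro mult_left_mono) auto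
  also have "\<dots> \<le> wnorm w (S t (unit_seq n))"
    using assms by (intro coord_le_wnorm S_ell1 unit_seq_ell1)
  finally show ?thesis .
qed

text \<open>The common induction step of both upper bounds. The second condition on \<open>K\<close>
  makes \<open>K * exp (- c * t)\<close> a supersolution of the equation for the norm, and the first
  places it above the initial value. It is used with \<open>C m = w m\<close> for the uniform bound
  and with unspecified constants for the decay of single unit sequences.\<close>

lemma wnorm_orbit_unit_le:
  assumes n: "n \<ge> 1"
    and C: "\<And>m t. 1 \<le> m \<Longrightarrow> m < n \<Longrightarrow> t \<ge> 0 \<Longrightarrow> wnorm w (S t (unit_seq m)) \<le> C m * exp (- c * t)"
    and K: "w n \<le> K" "a n * (\<Sum>m=1..<n. b m n * C m) \<le> (a n - c) * K"
    and t: "t \<ge> 0"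
  shows "wnorm w (S t (unit_seq n)) \<le> K * exp (- c * t)"
proof (rule wnorm_leI[OF S_ell1[OF t unit_seq_ell1[OF n]]])
  fix J
  \<comment> \<open>Partial sums replace the norm so that only finite sums are differentiated;
    positivity of the orbits allows the absolute values to be omitted.\<close>
  define p where "p m s = (\<Sum>k=1..J. w k * S s (unit_seq m) k)" for m s
  define D where "D s = (\<Sum>k=1..J. w k *
    (- a n * S s (unit_seq n) k + (\<Sum>m=1..<n. a n * b m n * S s (unit_seq m) k)))" for s
  have p_abs: "p m s = (\<Sum>k=1..J. w k * \<bar>S s (unit_seq m) k\<bar>)" if "m \<ge> 1" "s \<ge> 0" for m s
    unfolding p_def using that by (intro sum.cong refl) (simp add: orbit_unit_nonneg)
  have "0 \<le> K * exp (- c * t) - p n t"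
  proof (rule linear_differential_inequality[where d = "\<lambda>s. K * exp (- c * s) - p n s"
      and c = "a n" and D = "\<lambda>s. - c * K * exp (- c * s) - D s"])
    show "continuous_on {0..} (\<lambda>s. K * exp (- c * s) - p n s)"
      unfolding p_def by (auto intro!: continuous_intros orbit_unit_continuous n)
    \<comment> \<open>The value is \<open>w n\<close> or \<open>0\<close>, according to whether the
      cut-off \<open>J\<close> reaches \<open>n\<close>; either way it is at most
      \<open>w n\<close>.\<close>
    have "p n 0 = (\<Sum>k=1..J. if k = n then w n else 0)"
      unfolding p_def using n
      by (intro sum.cong refl) (auto simp: S_0 unit_seq_ell1, auto simp: unit_seq_def)
    also have "\<dots> \<le> w n" using weight_pos[OF n] by (simp add: sum.delta)
    finally show "0 \<le> K * exp (- c * 0) - p n 0" using K(1) by simp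
    fix s :: real assume s: "s > 0"
    have "(p n has_real_derivative D s) (at s)"
      unfolding p_def D_def by (intro DERIV_sum DERIV_cmult orbit_unit_derivative n s) auto
    then show "((\<lambda>s. K * exp (- c * s) - p n s) has_real_derivative - c * K * exp (- c * s) - D s) (at s)"
      by (auto intro!: derivative_eq_intros)
    have "D s = - a n * p n s + (\<Sum>k=1..J. \<Sum>m=1..<n. a n * (b m n * (w k * S s (unit_seq m) k)))"
      unfolding D_def p_def
      by (simp add: sum_distrib_left sum_subtractf sum_negf right_diff_distrib mult_ac)
    also have "(\<Sum>k=1..J. \<Sum>m=1..<n. a n * (b m n * (w k * S s (unit_seq m) k)))
        = a n * (\<Sum>m=1..<n. b m n * p m s)"
      unfolding p_def sum_distrib_left by (rule sum.swap)
    also have "\<dots> \<le> a n * (\<Sum>m=1..<n. b m n * (C m * exp (- c * s)))"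
    proof (intro mult_left_mono sum_mono a_nonneg b_nonneg n)
      fix m assume m: "m \<in> {1..<n}"
      have "p m s \<le> wnorm w (S s (unit_seq m))"
        using m s p_abs[of m s] sum_le_wnorm[OF S_ell1[OF _ unit_seq_ell1], of s m J] by simp
      also have "\<dots> \<le> C m * exp (- c * s)" using C m s by simp
      finally show "p m s \<le> C m * exp (- c * s)" .
    qed auto
    also have "\<dots> = a n * (\<Sum>m=1..<n. b m n * C m) * exp (- c * s)"
      by (simp add: sum_distrib_right sum_distrib_left mult_ac)
    also have "\<dots> \<le> (a n - c) * K * exp (- c * s)"
      by (intro mult_right_mono K) simp
    finally show "- a n * (K * exp (- c * s) - p n s) \<le> - c * K * exp (- c * s) - D s"
      by (simp add: algebra_simps)
  qed (rule t)
  then show "(\<Sum>k=1..J. w k * \<bar>S t (unit_seq n) k\<bar>) \<le> K * exp (- c * t)"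
    using p_abs[OF n t] by simp
qed

text \<open>By \<open>op_bound_from_units\<close> it suffices to bound the orbits of unit sequences
  by \<open>w n * exp (- c * t)\<close>. In the induction, \<open>weight_cond\<close> bounds the
  gain by \<open>\<kappa> * a n * w n\<close>, and the assumption on \<open>c\<close> says that this
  is at most \<open>(a n - c) * w n\<close>. The choice \<open>\<kappa> = 1\<close>,
  \<open>c = 0\<close> gives contractivity.\<close>

lemma wnorm_orbit_le:
  assumes \<kappa>: "0 \<le> \<kappa>" "weight_cond w b \<kappa>"
    and c: "\<And>n. n \<ge> 1 \<Longrightarrow> c \<le> (1 - \<kappa>) * a n"
    and t: "t \<ge> 0" and f: "f \<in> ell1 w"
  shows "wnorm w (S t f) \<le> exp (- c * t) * wnorm w f"
proof (rule op_bound_from_units[OF S_op[OF t] f])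
  have *: "wnorm w (S t (unit_seq n)) \<le> w n * exp (- c * t)" if "t \<ge> 0" "n \<ge> 1" for n t
    using that
  proof (induction n arbitrary: t rule: less_induct)
    case (less n)
    \<comment> \<open>The weight condition starts at index \<open>2\<close>. At index
      \<open>1\<close> the sum is empty and the sign of \<open>\<kappa>\<close> decides.\<close>
    have le: "(\<Sum>m=1..<n. b m n * w m) \<le> \<kappa> * w n"
    proof (cases "n = 1")
      case True
      then show ?thesis using \<kappa>(1) weight_pos[OF less.prems(2)] by simp
    next
      case False
      with less.prems have "{1..<n} = {1..n - 1}" "n \<ge> 2" by auto
      then show ?thesis using \<kappa>(2) by (simp add: weight_cond_def mult.commute)
    qed
    have "a n * (\<Sum>m=1..<n. b m n * w m) \<le> a n * (\<kappa> * w n)"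
      by (intro mult_left_mono le a_nonneg less.prems)
    also have "\<dots> \<le> (a n - c) * w n"
      using mult_right_mono[OF c[OF less.prems(2)], of "w n"] weight_pos[OF less.prems(2)]
      by (simp add: algebra_simps)
    finally have K: "a n * (\<Sum>m=1..<n. b m n * w m) \<le> (a n - c) * w n" .
    have IH: "wnorm w (S s (unit_seq m)) \<le> w m * exp (- c * s)"
      if "1 \<le> m" "m < n" "s \<ge> 0" for m s
      using that by (intro less.IH)
    show ?case
      by (rule wnorm_orbit_unit_le[OF less.prems(2) IH order_refl K less.prems(1)])
  qed
  show "wnorm w (S t (unit_seq n)) \<le> exp (- c * t) * w n" if "n \<ge> 1" for n
    using *[OF t that] by (simp only: mult.commute)
qed

text \<open>Since \<open>c\<close> lies strictly below \<open>a n\<close>, whatever constants the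
  smaller unit sequences have can be absorbed by a large \<open>K\<close>. The constant depends on
  \<open>n\<close>, so this controls finitely many unit sequences at a time.\<close>

lemma wnorm_orbit_unit_decay:
  assumes c: "\<And>m. 1 \<le> m \<Longrightarrow> m \<le> n \<Longrightarrow> c < a m" and n: "n \<ge> 1"
  shows "\<exists>K. \<forall>t\<ge>0. wnorm w (S t (unit_seq n)) \<le> K * exp (- c * t)"
  using assms
proof (induction n rule: less_induct)
  case (less n)
  have "\<exists>K. \<forall>t\<ge>0. wnorm w (S t (unit_seq m)) \<le> K * exp (- c * t)" if "1 \<le> m" "m < n" for m
    using less.IH[of m] less.prems that by auto
  then obtain C where C: "\<And>m t. 1 \<le> m \<Longrightarrow> m < n \<Longrightarrow> t \<ge> 0 \<Longrightarrow>
      wnorm w (S t (unit_seq m)) \<le> C m * exp (- c * t)"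
    by metis
  \<comment> \<open>The least constant that satisfies both requirements of
    \<open>wnorm_orbit_unit_le\<close>.\<close>
  define K where "K = max (w n) (a n * (\<Sum>m=1..<n. b m n * C m) / (a n - c))"
  have pos: "a n - c > 0" using less.prems by simp
  have "a n * (\<Sum>m=1..<n. b m n * C m) / (a n - c) \<le> K" by (simp add: K_def)
  with pos have "a n * (\<Sum>m=1..<n. b m n * C m) \<le> (a n - c) * K" by (simp add: field_simps)
  moreover have "w n \<le> K" by (simp add: K_def)
  ultimately have "wnorm w (S t (unit_seq n)) \<le> K * exp (- c * t)" if "t \<ge> 0" for t
    using that by (intro wnorm_orbit_unit_le[OF less.prems(2) C])
  then show ?case by blast
qed

section \<open>Convergence of orbits to zero, and obstructions to decay\<close>

lemma wnorm_orbit_unit_tendsto: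
  assumes a: "\<And>n. n \<ge> 1 \<Longrightarrow> 0 < a n" and n: "n \<ge> 1"
  shows "((\<lambda>t. wnorm w (S t (unit_seq n))) \<longlongrightarrow> 0) at_top"
proof -
  \<comment> \<open>Only the rates up to \<open>n\<close> matter, so a positive minimum exists;
    halving it yields the strict inequality \<open>c < a m\<close>.\<close>
  define c where "c = Min (a ` {1..n}) / 2"
  have "Min (a ` {1..n}) \<in> a ` {1..n}" using n by (intro Min_in) auto
  with a have c: "c > 0" by (auto simp: c_def)
  have "c < a m" if "1 \<le> m" "m \<le> n" for m
  proof -
    have "Min (a ` {1..n}) \<le> a m" using that by (intro Min_le) auto
    with c show ?thesis by (simp add: c_def)
  qed
  then obtain K where K: "\<And>t. t \<ge> 0 \<Longrightarrow> wnorm w (S t (unit_seq n)) \<le> K * exp (- c * t)"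
    using wnorm_orbit_unit_decay[OF _ n] by blast
  show ?thesis
  proof (rule tendsto_sandwich[where f = "\<lambda>_. 0"])
    show "((\<lambda>t. K * exp (- c * t)) \<longlongrightarrow> 0) at_top"
      by (intro tendsto_mult_right_zero exp_neg_tendsto c)
    show "\<forall>\<^sub>F t in at_top. 0 \<le> wnorm w (S t (unit_seq n))"
      using eventually_ge_at_top[of 0]
      by eventually_elim (intro wnorm_nonneg S_ell1 unit_seq_ell1 n)
    show "\<forall>\<^sub>F t in at_top. wnorm w (S t (unit_seq n)) \<le> K * exp (- c * t)"
      using eventually_ge_at_top[of 0] by eventually_elim (rule K)
  qed simp
qed

text \<open>A rate common to all unit sequences need not exist, so \<open>f\<close> is cut off: the
  truncated part decays as a finite sum of decaying orbits, and the small remainder stays small by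
  contractivity.\<close>

lemma orbit_tendsto_zero:
  assumes a: "\<And>n. n \<ge> 1 \<Longrightarrow> 0 < a n" and \<kappa>: "weight_cond w b 1" and f: "f \<in> ell1 w"
  shows "((\<lambda>t. wnorm w (S t f)) \<longlongrightarrow> 0) at_top"
proof (rule tendstoI)
  fix e :: real assume "e > 0"
  then have "\<forall>\<^sub>F N in sequentially. wnorm w (\<lambda>n. f n - trunc N f n) < e / 2"
    using order_tendstoD(2)[OF trunc_tendsto[OF f], of "e / 2"] by simp
  then obtain N where N: "wnorm w (\<lambda>n. f n - trunc N f n) < e / 2"
    by (meson eventually_happens trivial_limit_sequentially)
  have "((\<lambda>t. \<Sum>m=1..N. \<bar>f m\<bar> * wnorm w (S t (unit_seq m))) \<longlongrightarrow> 0) at_top"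
    by (intro tendsto_null_sum tendsto_mult_right_zero wnorm_orbit_unit_tendsto a) auto
  then have "\<forall>\<^sub>F t in at_top. (\<Sum>m=1..N. \<bar>f m\<bar> * wnorm w (S t (unit_seq m))) < e / 2"
    using \<open>e > 0\<close> by (intro order_tendstoD(2)) auto
  then show "\<forall>\<^sub>F t in at_top. dist (wnorm w (S t f)) 0 < e"
    using eventually_ge_at_top[of 0]
  proof eventually_elim
    case (elim t)
    \<comment> \<open>Contractivity is \<open>wnorm_orbit_le\<close> with rate \<open>0\<close> and
      \<open>\<kappa> = 1\<close>; the factor \<open>exp (- 0 * t)\<close> equals
      \<open>1\<close>.\<close>
    have "wnorm w (S t (\<lambda>n. f n - trunc N f n)) \<le> exp (- 0 * t) * wnorm w (\<lambda>n. f n - trunc N f n)"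
      by (rule wnorm_orbit_le[OF _ \<kappa> _ elim(2)]) (auto intro: ell1_diff f trunc_ell1)
    then have "wnorm w (S t f) < e"
      using wnorm_op_le_trunc[OF S_op[OF elim(2)] f, of N] elim(1) N
        wnorm_op_trunc_le[OF S_op[OF elim(2)], of N f] by simp
    then show ?case using wnorm_nonneg[OF S_ell1[OF elim(2) f]] by simp
  qed
qed

text \<open>The diagonal lower bound keeps \<open>exp (\<alpha> * t)\<close> times the norm of the
  orbit of \<open>unit_seq n\<close> above \<open>w n\<close>. Equality
  \<open>a n = \<alpha>\<close> is allowed; for \<open>\<alpha> = 0\<close> this shows that a
  vanishing rate excludes convergence to zero.\<close>

lemma not_exp_decay:
  assumes n: "n \<ge> 1" and \<alpha>: "a n \<le> \<alpha>"
  shows "\<not> exp_decay w S \<alpha>"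
proof
  assume "exp_decay w S \<alpha>"
  then have lim: "((\<lambda>t. exp (\<alpha> * t) * wnorm w (S t (unit_seq n))) \<longlongrightarrow> 0) at_top"
    using unit_seq_ell1[OF n] by (simp add: exp_decay_def)
  have "\<forall>\<^sub>F t in at_top. w n \<le> exp (\<alpha> * t) * wnorm w (S t (unit_seq n))"
    using eventually_ge_at_top[of 0]
  proof eventually_elim
    case (elim t)
    have "w n * 1 \<le> w n * exp ((\<alpha> - a n) * t)"
      using \<alpha> elim weight_pos[OF n] by (intro mult_left_mono) auto
    also have "\<dots> = exp (\<alpha> * t) * (w n * exp (- a n * t))"
      by (simp add: left_diff_distrib exp_diff exp_minus field_simps)
    also have "\<dots> \<le> exp (\<alpha> * t) * wnorm w (S t (unit_seq n))"
      by (intro mult_left_mono wnorm_orbit_unit_ge n elim) simp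
    finally show ?case by simp
  qed
  from tendsto_lowerbound[OF lim this] weight_pos[OF n] show False by simp
qed

end

section \<open>Characterization of decay and exponential rates\<close>

theorem theorem6p1:
  fixes a w :: "nat \<Rightarrow> real" and b :: "nat \<Rightarrow> nat \<Rightarrow> real"
    and S :: "real \<Rightarrow> (nat \<Rightarrow> real) \<Rightarrow> (nat \<Rightarrow> real)" and a0 :: real
  assumes "\<forall>n\<ge>1. 0 \<le> a n"
    and "\<forall>n\<ge>1. \<forall>j\<ge>1. 0 \<le> b n j"
    and "\<forall>n\<ge>1. \<forall>j\<ge>1. j \<le> n \<longrightarrow> b n j = 0"
    and "is_weight w"
    and "\<forall>n\<ge>1. real n \<le> w n"
    and "\<exists>\<kappa>. 0 < \<kappa> \<and> \<kappa> \<le> 1 \<and> weight_cond w b \<kappa>"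
    and "frag_semigroup w a b S"
    and "a0 = (INF n\<in>{1..}. a n)"
  shows "((\<forall>u\<in>ell1 w. ((\<lambda>t. wnorm w (S t u)) \<longlongrightarrow> 0) at_top) \<longleftrightarrow> (\<forall>n\<ge>1. 0 < a n)) \<and>
    (\<forall>\<kappa>. 0 < \<kappa> \<and> \<kappa> < 1 \<and> weight_cond w b \<kappa> \<longrightarrow>
      (\<forall>t\<ge>0. op_norm w (S t) \<le> exp (- (1 - \<kappa>) * a0 * t)) \<and>
      (\<forall>\<alpha>. 0 < a0 \<and> 0 \<le> \<alpha> \<and> \<alpha> < (1 - \<kappa>) * a0 \<longrightarrow> exp_decay w S \<alpha>) \<and>
      (\<forall>\<alpha>. a0 < \<alpha> \<longrightarrow> \<not> exp_decay w S \<alpha>) \<and>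
      (a0 = 0 \<longrightarrow> (\<forall>\<alpha>>0. \<not> exp_decay w S \<alpha>)))"
proof -
  interpret fragmentation w a b S
    using assms by unfold_locales auto
  have bdd: "bdd_below (a ` {1..})"
    using a_nonneg by (intro bdd_belowI2[of _ 0]) auto
  have a0_le: "a0 \<le> a n" if "n \<ge> 1" for n
    unfolding assms(8) using that by (intro cINF_lower bdd) auto
  have not_decay: "\<not> exp_decay w S \<alpha>" if \<alpha>: "a0 < \<alpha>" for \<alpha>
  proof -
    \<comment> \<open>The infimum may fail to be attained, but some rate lies below any number
      larger than it.\<close>
    obtain n where "n \<ge> 1" "a n < \<alpha>"
      using \<alpha> cINF_less_iff[OF _ bdd, of \<alpha>] unfolding assms(8) by auto
    then show ?thesis by (intro not_exp_decay[of n]) auto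
  qed
  \<comment> \<open>The weight condition is monotone in \<open>\<kappa>\<close>, and the value
    \<open>1\<close> is the one that yields contractivity.\<close>
  have cond_1: "weight_cond w b 1"
  proof -
    obtain \<kappa> where \<kappa>: "\<kappa> \<le> 1" "weight_cond w b \<kappa>" using assms(6) by blast
    have "\<kappa> * w j \<le> 1 * w j" if "j \<ge> 2" for j
      using \<kappa>(1) weight_pos[of j] that by (intro mult_right_mono) auto
    with \<kappa>(2) show ?thesis unfolding weight_cond_def by (meson order_trans)
  qed
  have "(\<forall>u\<in>ell1 w. ((\<lambda>t. wnorm w (S t u)) \<longlongrightarrow> 0) at_top) \<longleftrightarrow> (\<forall>n\<ge>1. 0 < a n)"
  proof
    assume "\<forall>u\<in>ell1 w. ((\<lambda>t. wnorm w (S t u)) \<longlongrightarrow> 0) at_top"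
    \<comment> \<open>Plain convergence to zero is exponential decay at rate \<open>0\<close>, which
      \<open>not_exp_decay\<close> refutes as soon as some \<open>a n\<close> is not
      positive.\<close>
    then have "exp_decay w S 0" by (simp add: exp_decay_def)
    then show "\<forall>n\<ge>1. 0 < a n" using not_exp_decay[of _ 0] by (meson not_le)
  next
    assume "\<forall>n\<ge>1. 0 < a n"
    then show "\<forall>u\<in>ell1 w. ((\<lambda>t. wnorm w (S t u)) \<longlongrightarrow> 0) at_top"
      by (auto intro!: orbit_tendsto_zero cond_1)
  qed
  moreover have "(\<forall>t\<ge>0. op_norm w (S t) \<le> exp (- (1 - \<kappa>) * a0 * t)) \<and>
      (\<forall>\<alpha>. 0 < a0 \<and> 0 \<le> \<alpha> \<and> \<alpha> < (1 - \<kappa>) * a0 \<longrightarrow> exp_decay w S \<alpha>)"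
    if \<kappa>: "0 < \<kappa>" "\<kappa> < 1" "weight_cond w b \<kappa>" for \<kappa>
  proof -
    have bound: "wnorm w (S t f) \<le> exp (- ((1 - \<kappa>) * a0) * t) * wnorm w f"
      if "t \<ge> 0" "f \<in> ell1 w" for t f
      using \<kappa> by (intro wnorm_orbit_le[of \<kappa>] that mult_left_mono a0_le) auto
    have "op_norm w (S t) \<le> exp (- (1 - \<kappa>) * a0 * t)" if "t \<ge> 0" for t
      unfolding op_norm_def
    proof (rule cSUP_least)
      have "(\<lambda>n. 0) \<in> {f \<in> ell1 w. wnorm w f \<le> 1}" by simp
      then show "{f \<in> ell1 w. wnorm w f \<le> 1} \<noteq> {}" by blast
      fix f assume f: "f \<in> {f \<in> ell1 w. wnorm w f \<le> 1}"
      then have "wnorm w (S t f) \<le> exp (- ((1 - \<kappa>) * a0) * t) * wnorm w f"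
        by (intro bound that) simp
      also have "\<dots> \<le> exp (- ((1 - \<kappa>) * a0) * t)"
        using f by (intro mult_left_le) auto
      finally show "wnorm w (S t f) \<le> exp (- (1 - \<kappa>) * a0 * t)"
        by (simp only: mult_minus_left mult.assoc)
    qed
    moreover have "exp_decay w S \<alpha>" if \<alpha>: "\<alpha> < (1 - \<kappa>) * a0" for \<alpha>
      unfolding exp_decay_def
    proof
      fix u assume u: "u \<in> ell1 w"
      \<comment> \<open>The gap between the guaranteed rate and \<open>\<alpha>\<close>; it remains
        as decay rate after multiplication by \<open>exp (\<alpha> * t)\<close>.\<close>
      define c where "c = (1 - \<kappa>) * a0 - \<alpha>"
      have c: "c > 0" using \<alpha> by (simp add: c_def)
      show "((\<lambda>t. exp (\<alpha> * t) * wnorm w (S t u)) \<longlongrightarrow> 0) at_top"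
      proof (rule tendsto_sandwich[where f = "\<lambda>_. 0"])
        show "((\<lambda>t. exp (- c * t) * wnorm w u) \<longlongrightarrow> 0) at_top"
          by (intro tendsto_mult_left_zero exp_neg_tendsto c)
        show "\<forall>\<^sub>F t in at_top. 0 \<le> exp (\<alpha> * t) * wnorm w (S t u)"
          using eventually_ge_at_top[of 0]
          by eventually_elim (intro mult_nonneg_nonneg wnorm_nonneg S_ell1 u, simp_all)
        show "\<forall>\<^sub>F t in at_top. exp (\<alpha> * t) * wnorm w (S t u) \<le> exp (- c * t) * wnorm w u"
          using eventually_ge_at_top[of 0]
        proof eventually_elim
          case (elim t)
          have "exp (\<alpha> * t) * wnorm w (S t u)
              \<le> exp (\<alpha> * t) * (exp (- ((1 - \<kappa>) * a0) * t) * wnorm w u)"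
            by (intro mult_left_mono bound elim u) simp
          also have "\<dots> = exp (- c * t) * wnorm w u"
            unfolding c_def mult.assoc[symmetric] exp_add[symmetric] by (simp add: algebra_simps)
          finally show ?case .
        qed
      qed simp
    qed
    ultimately show ?thesis by blast
  qed
  moreover have "a0 = 0 \<longrightarrow> (\<forall>\<alpha>>0. \<not> exp_decay w S \<alpha>)"
    using not_decay by simp
  ultimately show ?thesis using not_decay by blast
qed

end
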